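(* Let $G$ be a finitely generated abelian-by-finite group, let $\pi\colon G\to G^{ab}=G/G'$ be the abelianization map, and let $\mathsf{T}(G^{ab})$ be the torsion subgroup of $G^{ab}$. Then $\mathsf{T}_{\bullet}(G)=\pi^{-1}(\mathsf{T}(G^{ab}))$. In particular: (1) $\mathsf{T}_{\bullet}(G)$ is a normal subgroup of $G$; (2) $\mathsf{T}_{\bullet}(G)=G$ if and only if $G^{ab}$ is finite; (3) additionally, if $G$ is torsion-free, then $\mathsf{T}_{\bullet}(G)=G$ if and only if $Z(G)=1$.
   Context: For elements $x,y$ of a group, $x^y$ denotes $y^{-1}xy$. An element $g$ of a group $G$ is called generalized torsion if there exist an integer $k\ge 1$ and $x_1,\dots,x_k\in G$ such that $g^{x_1}g^{x_2}\cdots g^{x_k}=1$. The set of all generalized torsion elements of $G$ is denoted $\mathsf{T}_{\bullet}(G)$. A group is abelian-by-finite if it has an abelian normal subgroup of finite index. $Z(G)$ denotes the center of $G$ and $G'$ its derived subgroup. *)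

theory Defs
  imports "HOL-Algebra.Algebra"
begin

definition conjugate :: "('a, 'b) monoid_scheme \<Rightarrow> 'a \<Rightarrow> 'a \<Rightarrow> 'a" where
  "conjugate G g x = inv\<^bsub>G\<^esub> x \<otimes>\<^bsub>G\<^esub> g \<otimes>\<^bsub>G\<^esub> x"

text \<open>The list \<open>xs\<close> is \<open>x\<^sub>1, \<dots>, x\<^sub>k\<close>; the product \<open>g\<^bsup>x\<^sub>1\<^esup> \<cdots> g\<^bsup>x\<^sub>k\<^esup>\<close> is taken in this order.\<close>

definition generalized_torsion :: "('a, 'b) monoid_scheme \<Rightarrow> 'a \<Rightarrow> bool" where
  "generalized_torsion G g \<longleftrightarrow> g \<in> carrier G \<and>
     (\<exists>xs. length xs \<ge> 1 \<and> set xs \<subseteq> carrier G \<and>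
        foldr (\<otimes>\<^bsub>G\<^esub>) (map (conjugate G g) xs) \<one>\<^bsub>G\<^esub> = \<one>\<^bsub>G\<^esub>)"

definition generalized_torsion_set :: "('a, 'b) monoid_scheme \<Rightarrow> 'a set" where
  "generalized_torsion_set G = {g. generalized_torsion G g}"

definition torsion_set :: "('a, 'b) monoid_scheme \<Rightarrow> 'a set" where
  "torsion_set G = {g \<in> carrier G. \<exists>n::nat. n \<ge> 1 \<and> g [^]\<^bsub>G\<^esub> n = \<one>\<^bsub>G\<^esub>}"

definition torsion_free :: "('a, 'b) monoid_scheme \<Rightarrow> bool" where
  "torsion_free G \<longleftrightarrow> torsion_set G = {\<one>\<^bsub>G\<^esub>}"

definition finitely_generated :: "('a, 'b) monoid_scheme \<Rightarrow> bool" where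
  "finitely_generated G \<longleftrightarrow>
     (\<exists>S. finite S \<and> S \<subseteq> carrier G \<and> generate G S = carrier G)"

definition abelian_by_finite :: "('a, 'b) monoid_scheme \<Rightarrow> bool" where
  "abelian_by_finite G \<longleftrightarrow>
     (\<exists>A. A \<lhd> G \<and> comm_group (G\<lparr>carrier := A\<rparr>) \<and> finite (rcosets\<^bsub>G\<^esub> A))"

definition center :: "('a, 'b) monoid_scheme \<Rightarrow> 'a set" where
  "center G = {z \<in> carrier G. \<forall>x \<in> carrier G. z \<otimes>\<^bsub>G\<^esub> x = x \<otimes>\<^bsub>G\<^esub> z}"

definition abelianization :: "('a, 'b) monoid_scheme \<Rightarrow> 'a set monoid" where
  "abelianization G = G Mod derived G (carrier G)"

definition abelianization_map :: "('a, 'b) monoid_scheme \<Rightarrow> 'a \<Rightarrow> 'a set" where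
  "abelianization_map G g = derived G (carrier G) #>\<^bsub>G\<^esub> g"

end

theory Submission
  imports Defs
begin

text \<open>
  Let \<open>A\<close> be an abelian normal subgroup of finite index. The transfer \<open>G \<rightarrow> A\<close> is a homomorphism
  into an abelian group, so it kills \<open>G'\<close>; on \<open>A\<close> it is the product of the conjugates by a
  transversal, because \<open>A\<close> fixes its own cosets. If some positive power of \<open>g\<close> lies in \<open>G'\<close>, then so
  does some positive power \<open>h = g\<^sup>n \<in> A\<close>. The transfer of \<open>h\<close> is then trivial and is at the same
  time a product of conjugates of \<open>g\<close>, since every conjugate of \<open>g\<^sup>n\<close> is the \<open>n\<close>-th power of a
  conjugate of \<open>g\<close>. For (3), the transfer of an element of \<open>A\<close> is central, since
  conjugation permutes its factors, hence trivial if the centre is.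
\<close>

section \<open>Products of conjugates\<close>

text \<open>The number of factors is kept as an index because it adds up under multiplication and
  becomes the exponent in an abelian image. At \<open>n = 0\<close> only the empty product remains,
  which generalized torsion must exclude.\<close>

definition conjugate_products :: "('a, 'b) monoid_scheme \<Rightarrow> 'a \<Rightarrow> nat \<Rightarrow> 'a set" where
  "conjugate_products G g n =
     {foldr (\<otimes>\<^bsub>G\<^esub>) (map (conjugate G g) xs) \<one>\<^bsub>G\<^esub> | xs. length xs = n \<and> set xs \<subseteq> carrier G}"

lemma generalized_torsion_iff:
  "generalized_torsion G g \<longleftrightarrow>
     g \<in> carrier G \<and> (\<exists>n\<ge>1. \<one>\<^bsub>G\<^esub> \<in> conjugate_products G g n)"
  unfolding generalized_torsion_def conjugate_products_def by auto metis+

context group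
begin

lemma mult_inv_cancel_left:
  assumes "x \<in> carrier G" "y \<in> carrier G"
  shows "x \<otimes> (inv x \<otimes> y) = y" "inv x \<otimes> (x \<otimes> y) = y"
  using assms by (simp_all flip: m_assoc)

lemma conjugate_closed [simp, intro]:
  "g \<in> carrier G \<Longrightarrow> x \<in> carrier G \<Longrightarrow> conjugate G g x \<in> carrier G"
  by (simp add: conjugate_def)

lemma foldr_mult_closed:
  "set us \<subseteq> carrier G \<Longrightarrow> foldr (\<otimes>) us \<one> \<in> carrier G"
  by (induction us) auto

lemma foldr_mult_append:
  "set us \<subseteq> carrier G \<Longrightarrow> set vs \<subseteq> carrier G \<Longrightarrow>
   foldr (\<otimes>) (us @ vs) \<one> = foldr (\<otimes>) us \<one> \<otimes> foldr (\<otimes>) vs \<one>"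
  by (induction us) (simp_all add: foldr_mult_closed m_assoc)

lemma conjugate_products_one: "\<one> \<in> conjugate_products G g 0"
  by (auto simp: conjugate_products_def)

lemma conjugate_products_conjugate:
  assumes "g \<in> carrier G" "x \<in> carrier G"
  shows "conjugate G g x \<in> conjugate_products G g 1"
  unfolding conjugate_products_def using assms by (auto intro!: exI[of _ "[x]"])

lemma conjugate_products_mult:
  assumes "g \<in> carrier G" "u \<in> conjugate_products G g m" "v \<in> conjugate_products G g n"
  shows "u \<otimes> v \<in> conjugate_products G g (m + n)"
proof -
  obtain xs where xs: "length xs = m" "set xs \<subseteq> carrier G"
      "u = foldr (\<otimes>) (map (conjugate G g) xs) \<one>"
    using assms(2) unfolding conjugate_products_def by auto
  obtain ys where ys: "length ys = n" "set ys \<subseteq> carrier G"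
      "v = foldr (\<otimes>) (map (conjugate G g) ys) \<one>"
    using assms(3) unfolding conjugate_products_def by auto
  have "u \<otimes> v = foldr (\<otimes>) (map (conjugate G g) (xs @ ys)) \<one>"
    unfolding map_append xs(3) ys(3)
    by (rule foldr_mult_append[symmetric]) (use assms(1) xs(2) ys(2) in auto)
  then show ?thesis
    unfolding conjugate_products_def using xs(1,2) ys(1,2) by (auto intro!: exI[of _ "xs @ ys"])
qed

lemma conjugate_mult:
  assumes "g \<in> carrier G" "h \<in> carrier G" "x \<in> carrier G"
  shows "conjugate G (g \<otimes> h) x = conjugate G g x \<otimes> conjugate G h x"
  using assms by (simp add: conjugate_def m_assoc mult_inv_cancel_left)

text \<open>Conjugation by \<open>x\<close> is multiplicative, so the conjugate of the power is the
  \<open>n\<close>-th power of one conjugate, hence a product of \<open>n\<close> conjugates of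
  \<open>g\<close>.\<close>

lemma conjugate_pow_in_conjugate_products:
  assumes g: "g \<in> carrier G" and x: "x \<in> carrier G"
  shows "conjugate G (g [^] n) x \<in> conjugate_products G g n"
proof (induction n)
  case 0
  then show ?case using x conjugate_products_one by (simp add: conjugate_def)
next
  case (Suc n)
  then have "conjugate G (g [^] n) x \<otimes> conjugate G g x \<in> conjugate_products G g (n + 1)"
    by (intro conjugate_products_mult g conjugate_products_conjugate x)
  then show ?case using g x by (simp add: conjugate_mult)
qed

end

section \<open>Torsion and generalized torsion modulo the derived subgroup\<close>

text \<open>An abelian target does not see conjugation: every factor maps to \<open>h g\<close>.
  Applied to the abelianization map, this shows that generalized torsion elements have torsion
  image.\<close>

lemma (in group_hom) hom_conjugate_products:
  assumes "comm_group H" "g \<in> carrier G" "u \<in> conjugate_products G g n"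
  shows "h u = h g [^]\<^bsub>H\<^esub> n"
proof -
  interpret H: comm_group H by fact
  have "h (foldr (\<otimes>) (map (conjugate G g) xs) \<one>) = h g [^]\<^bsub>H\<^esub> length xs"
    if "set xs \<subseteq> carrier G" for xs
    using that
  proof (induction xs)
    case (Cons x xs)
    have "h (conjugate G g x) = h g"
      using Cons.prems assms(2)
      by (simp add: conjugate_def H.m_comm[of "inv\<^bsub>H\<^esub> h x"] H.m_assoc)
    moreover have "foldr (\<otimes>) (map (conjugate G g) xs) \<one> \<in> carrier G"
      by (rule G.foldr_mult_closed) (use Cons.prems assms(2) in auto)
    ultimately show ?case
      using Cons assms(2) by (simp add: H.m_comm)
  qed simp
  then show ?thesis
    using assms(3) unfolding conjugate_products_def by auto
qed

text \<open>The image of the derived subgroup is the derived subgroup of the image, which is trivial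
  in an abelian group. This is how the transfer comes to kill the derived subgroup.\<close>

lemma (in group_hom) hom_derived_eq_one:
  assumes "comm_group H" "x \<in> derived G (carrier G)"
  shows "h x = \<one>\<^bsub>H\<^esub>"
proof -
  have "h ` derived G (carrier G) = derived H (h ` carrier G)"
    by (simp add: derived_img)
  also have "\<dots> = {\<one>\<^bsub>H\<^esub>}"
    by (rule comm_group.derived_eq_singleton[OF assms(1)]) auto
  finally show ?thesis using assms(2) by blast
qed

section \<open>Torsion in abelian groups\<close>

context comm_group
begin

lemma torsion_set_mult_closed:
  assumes "x \<in> torsion_set G" "y \<in> torsion_set G"
  shows "x \<otimes> y \<in> torsion_set G"
proof -
  obtain m n :: nat where mn: "m \<ge> 1" "x [^] m = \<one>" "n \<ge> 1" "y [^] n = \<one>"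
    and xy: "x \<in> carrier G" "y \<in> carrier G"
    using assms unfolding torsion_set_def by blast
  have "(x \<otimes> y) [^] (m * n) = (x [^] m) [^] n \<otimes> (y [^] n) [^] m"
    using xy by (simp add: nat_pow_distrib nat_pow_pow mult.commute)
  also have "\<dots> = \<one>" using mn by simp
  finally have "(x \<otimes> y) [^] (m * n) = \<one>" .
  moreover have "m * n \<ge> 1" using mn by simp
  ultimately show ?thesis unfolding torsion_set_def using xy by blast
qed

lemma subgroup_torsion_set: "subgroup (torsion_set G) G"
proof (rule subgroupI)
  show "torsion_set G \<subseteq> carrier G"
    unfolding torsion_set_def by blast
  have "\<one> [^] (1::nat) = \<one>" by simp
  then have "\<one> \<in> torsion_set G"
    unfolding torsion_set_def by blast
  then show "torsion_set G \<noteq> {}" by blast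
  show "inv x \<in> torsion_set G" if "x \<in> torsion_set G" for x
    using that unfolding torsion_set_def by (auto simp: nat_pow_inv)
qed (rule torsion_set_mult_closed)

text \<open>Adjoin one generator at a time: in an abelian group the product set of two subgroups is
  a subgroup, and it is finite if both are. It contains the enlarged generating set, hence
  everything generated by it.\<close>

lemma finite_generate_torsion:
  assumes "finite S" "S \<subseteq> torsion_set G"
  shows "finite (generate G S)"
  using assms
proof (induction rule: finite_induct)
  case empty
  then show ?case by (simp add: generate_empty)
next
  case (insert a S)
  have car: "a \<in> carrier G" "S \<subseteq> carrier G"
    using insert.prems unfolding torsion_set_def by auto
  obtain n :: nat where "n \<ge> 1" "a [^] n = \<one>"
    using insert.prems unfolding torsion_set_def by auto
  \<comment> \<open>Both conventions assign 0 to the infinite case: \<open>ord a = 0\<close> for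
    infinite order and \<open>card\<close> of an infinite set. As \<open>ord a\<close> is the
    cardinality of the cyclic subgroup, a nonzero value makes that subgroup finite.\<close>
  then have "ord a \<noteq> 0"
    using car(1) by (auto simp: ord_eq_0 Suc_le_eq)
  then have "finite (generate G {a})"
    using generate_pow_card[OF car(1)] card_eq_0_iff by metis
  then have fin: "finite (generate G {a} <#> generate G S)"
    using insert unfolding set_mult_def by auto
  have sub: "subgroup (generate G {a}) G" "subgroup (generate G S) G"
    using car by (auto intro: generate_is_subgroup)
  have "a \<otimes> \<one> \<in> generate G {a} <#> generate G S"
    unfolding set_mult_def using generate.one generate.incl[of a "{a}"] by blast
  moreover have "\<one> \<otimes> s \<in> generate G {a} <#> generate G S" if "s \<in> S" for s
    unfolding set_mult_def using generate.one generate.incl[of s S] that by blast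
  ultimately have "insert a S \<subseteq> generate G {a} <#> generate G S"
    using car by (simp add: subset_iff)
  then have "generate G (insert a S) \<subseteq> generate G {a} <#> generate G S"
    by (intro generate_subgroup_incl mult_subgroups sub)
  then show ?case using fin finite_subset by blast
qed

lemma finite_iff_torsion:
  assumes "finitely_generated G"
  shows "finite (carrier G) \<longleftrightarrow> torsion_set G = carrier G"
proof
  assume fin: "finite (carrier G)"
  then have "order G \<ge> 1" by (simp add: order_gt_0_iff_finite Suc_leI)
  then have "carrier G \<subseteq> torsion_set G"
    unfolding torsion_set_def using pow_order_eq_1 by blast
  then show "torsion_set G = carrier G"
    unfolding torsion_set_def by blast
next
  assume "torsion_set G = carrier G"
  then show "finite (carrier G)"
    using assms finite_generate_torsion unfolding finitely_generated_def by metis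
qed

end

section \<open>Images, preimages and powers in quotients\<close>

lemma (in group_hom) finitely_generated_image:
  assumes "finitely_generated G" "h ` carrier G = carrier H"
  shows "finitely_generated H"
proof -
  obtain S where "finite S" "S \<subseteq> carrier G" "generate G S = carrier G"
    using assms(1) unfolding finitely_generated_def by blast
  then show ?thesis
    unfolding finitely_generated_def using assms(2) generate_img[of S]
    by (intro exI[of _ "h ` S"]) auto
qed

text \<open>Conjugating \<open>g\<close> leaves \<open>h g\<close> unchanged in an abelian group, so
  the preimage is conjugation invariant. With \<open>K\<close> the torsion subgroup this yields
  claim (1).\<close>

lemma (in group_hom) normal_vimage_comm_group:
  assumes "comm_group H" "subgroup K H"
  shows "{g \<in> carrier G. h g \<in> K} \<lhd> G"
proof (rule G.normal_invI)
  interpret H: comm_group H by fact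
  interpret K: subgroup K H by fact
  show "subgroup {g \<in> carrier G. h g \<in> K} G"
    by (rule G.subgroupI) (auto intro!: exI[of _ \<one>])
  show "x \<otimes> g \<otimes> inv x \<in> {g \<in> carrier G. h g \<in> K}"
    if "x \<in> carrier G" "g \<in> {g \<in> carrier G. h g \<in> K}" for x g
    using that by (simp add: H.m_comm[of "h x"] H.m_assoc)
qed

text \<open>Serves two quotients: the one by the derived subgroup, to read off torsion there, and
  the finite one by \<open>A\<close>, to find powers lying in \<open>A\<close>.\<close>

lemma (in normal) FactGroup_pow_coset:
  assumes "g \<in> carrier G"
  shows "(H #> g) [^]\<^bsub>G Mod H\<^esub> (n::nat) = \<one>\<^bsub>G Mod H\<^esub> \<longleftrightarrow> g [^] n \<in> H"
proof -
  interpret q: group_hom G "G Mod H" "\<lambda>a. H #> a"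
    by (intro group_hom.intro group_hom_axioms.intro factorgroup_is_group r_coset_hom_Mod is_group)
  have "(H #> g) [^]\<^bsub>G Mod H\<^esub> n = H #> (g [^] n)"
    using q.hom_nat_pow[OF assms, of n] by simp
  moreover have "H #> (g [^] n) = H \<longleftrightarrow> g [^] n \<in> H"
    using coset_join1[OF _ nat_pow_closed[OF assms] subgroup_axioms]
      coset_join2[OF nat_pow_closed[OF assms] subgroup_axioms] by (rule iffI)
  ultimately show ?thesis by simp
qed

section \<open>The transfer into an abelian normal subgroup of finite index\<close>

lemma (in group_hom) hom_finprod:
  assumes "comm_group G" "comm_group H" "f \<in> I \<rightarrow> carrier G"
  shows "h (finprod G f I) = finprod H (\<lambda>i. h (f i)) I"
proof -
  interpret G: comm_group G by fact
  interpret H: comm_group H by fact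
  show ?thesis
    using assms(3)
  proof (induction I rule: infinite_finite_induct)
    case (insert i I)
    then have "f \<in> I \<rightarrow> carrier G" "f i \<in> carrier G" by auto
    moreover from this have "(\<lambda>i. h (f i)) \<in> I \<rightarrow> carrier H" by (simp add: Pi_iff)
    ultimately show ?case
      using insert by simp
  qed simp_all
qed

locale abelian_normal_finite_index = normal A G for A and G (structure) +
  assumes comm_group_A: "comm_group (G\<lparr>carrier := A\<rparr>)"
    and finite_rcosets: "finite (rcosets A)"
begin

abbreviation H where "H \<equiv> G\<lparr>carrier := A\<rparr>"

sublocale H: comm_group H
  by (rule comm_group_A)

lemma A_comm: "a \<in> A \<Longrightarrow> b \<in> A \<Longrightarrow> a \<otimes> b = b \<otimes> a"
  using H.m_comm by simp

text \<open>One global choice of a transversal; the value is meaningful only on nonempty sets, in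
  particular on cosets.\<close>

definition rep :: "'a set \<Rightarrow> 'a" where
  "rep C = (SOME x. x \<in> C)"

definition factor :: "'a \<Rightarrow> 'a set \<Rightarrow> 'a" where
  "factor g C = rep C \<otimes> g \<otimes> inv rep (C #> g)"

text \<open>The product is formed in \<open>H\<close>, that is in \<open>A\<close> as a commutative
  group, so no order on the cosets has to be fixed.\<close>

definition transfer :: "'a \<Rightarrow> 'a" where
  "transfer g = finprod H (factor g) (rcosets A)"

lemma rep_mem:
  assumes "C \<in> rcosets A"
  shows "rep C \<in> C"
proof -
  obtain x where "x \<in> carrier G" "C = A #> x"
    using assms unfolding RCOSETS_def by blast
  then have "x \<in> C"
    using rcos_self[OF _ subgroup_axioms] by simp
  then show ?thesis
    unfolding rep_def by (rule someI)
qed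

lemma rep_closed [simp]: "C \<in> rcosets A \<Longrightarrow> rep C \<in> carrier G"
  using rep_mem rcosets_carrier[OF is_group] by blast

lemma rcoset_rep:
  assumes "C \<in> rcosets A"
  shows "A #> rep C = C"
proof -
  obtain x where x: "x \<in> carrier G" "C = A #> x"
    using assms unfolding RCOSETS_def by blast
  then show ?thesis
    using repr_independence[OF _ x(1) subgroup_axioms, of "rep C"] rep_mem[OF assms] by simp
qed

lemma rcoset_mult [simp]:
  assumes "C \<in> rcosets A" "g \<in> carrier G"
  shows "C #> g \<in> rcosets A"
proof -
  obtain x where "x \<in> carrier G" "C = A #> x"
    using assms(1) unfolding RCOSETS_def by blast
  then have "C #> g = A #> (x \<otimes> g)" "x \<otimes> g \<in> carrier G"
    using assms(2) subset by (simp_all add: coset_mult_assoc)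
  then show ?thesis
    using subset by (simp add: rcosetsI)
qed

lemma rcoset_subset: "C \<in> rcosets A \<Longrightarrow> C \<subseteq> carrier G"
  by (rule rcosets_carrier[OF is_group])

lemma rcoset_mult_assoc:
  assumes "C \<in> rcosets A" "g \<in> carrier G" "h \<in> carrier G"
  shows "(C #> g) #> h = C #> (g \<otimes> h)"
  using assms rcoset_subset by (simp add: coset_mult_assoc)

lemma rcoset_mult_one: "C \<in> rcosets A \<Longrightarrow> C #> \<one> = C"
  using rcoset_subset by (simp add: coset_mult_one)

lemma bij_betw_rcoset_mult:
  assumes "g \<in> carrier G"
  shows "bij_betw (\<lambda>C. C #> g) (rcosets A) (rcosets A)"
  by (rule bij_betw_byWitness[of _ "\<lambda>C. C #> inv g"])
    (use assms in \<open>auto simp: rcoset_mult_assoc rcoset_mult_one\<close>)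

text \<open>Both \<open>rep C \<otimes> g\<close> and \<open>rep (C #> g)\<close> lie in the right
  coset \<open>C #> g\<close>, so their quotient is in \<open>A\<close>.\<close>

lemma factor_closed:
  assumes "C \<in> rcosets A" "g \<in> carrier G"
  shows "factor g C \<in> A"
proof -
  have "A #> (rep C \<otimes> g) = C #> g"
    using assms by (simp add: coset_mult_assoc[symmetric] subset rcoset_rep)
  then have "rep (C #> g) \<in> A #> (rep C \<otimes> g)"
    using rep_mem assms by simp
  then have "A #> (rep C \<otimes> g) = A #> rep (C #> g)"
    using assms by (intro repr_independence subgroup_axioms) auto
  then have "rep C \<otimes> g \<in> A #> rep (C #> g)"
    using assms by (intro repr_independenceD subgroup_axioms) auto
  then show ?thesis
    unfolding factor_def by (intro rcos_module_imp is_group) (use assms in auto)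
qed

text \<open>The cocycle identity: the inverse of \<open>rep (C #> g)\<close> ending the first factor
  cancels against \<open>rep (C #> g)\<close> starting the second.\<close>

lemma factor_mult:
  assumes "C \<in> rcosets A" "g \<in> carrier G" "h \<in> carrier G"
  shows "factor (g \<otimes> h) C = factor g C \<otimes> factor h (C #> g)"
proof -
  have "rep (C #> g) \<in> carrier G" "rep (C #> (g \<otimes> h)) \<in> carrier G" "rep C \<in> carrier G"
    using assms by simp_all
  then show ?thesis
    using assms unfolding factor_def
    by (simp add: rcoset_mult_assoc m_assoc mult_inv_cancel_left)
qed

lemma group_hom_transfer: "group_hom G H transfer"
proof (intro group_hom.intro group_hom_axioms.intro is_group H.is_group homI)
  show "transfer g \<in> carrier H" if "g \<in> carrier G" for g
    unfolding transfer_def by (rule H.finprod_closed) (use that factor_closed in auto)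
  show "transfer (g \<otimes> h) = transfer g \<otimes>\<^bsub>H\<^esub> transfer h"
    if g: "g \<in> carrier G" and h: "h \<in> carrier G" for g h
  proof -
    have "transfer (g \<otimes> h) = finprod H (\<lambda>C. factor g C \<otimes>\<^bsub>H\<^esub> factor h (C #> g)) (rcosets A)"
      unfolding transfer_def
      by (rule H.finprod_cong') (use g h in \<open>auto simp: factor_mult factor_closed\<close>)
    also have "\<dots> = finprod H (factor g) (rcosets A) \<otimes>\<^bsub>H\<^esub>
                    finprod H (\<lambda>C. factor h (C #> g)) (rcosets A)"
      by (rule H.finprod_multf) (use g h in \<open>auto simp: factor_closed\<close>)
    \<comment> \<open>The shifted cosets run through all cosets exactly once, so the shift by
      \<open>g\<close> disappears from the product.\<close>
    also have "finprod H (\<lambda>C. factor h (C #> g)) (rcosets A)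
               = finprod H (factor h) ((\<lambda>C. C #> g) ` (rcosets A))"
      by (rule H.finprod_reindex[symmetric])
        (use g h bij_betw_rcoset_mult[OF g] in \<open>auto simp: factor_closed bij_betw_def\<close>)
    also have "(\<lambda>C. C #> g) ` (rcosets A) = rcosets A"
      using bij_betw_rcoset_mult[OF g] by (simp add: bij_betw_def)
    finally show ?thesis
      unfolding transfer_def .
  qed
qed

section \<open>The transfer on \<open>A\<close> and generalized torsion\<close>

lemma rcoset_mult_normal:
  assumes "C \<in> rcosets A" "a \<in> A"
  shows "C #> a = C"
proof -
  obtain x where x: "x \<in> carrier G" "C = A #> x"
    using assms(1) unfolding RCOSETS_def by blast
  \<comment> \<open>By normality \<open>C\<close> is also a left coset of \<open>A\<close>, and left
    cosets absorb right multiplication by \<open>a\<close>.\<close>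
  then have C: "C = x <# A"
    using coset_eq by simp
  have "C #> a = x <# (A #> a)"
    unfolding C using x(1) assms(2) subset by (simp add: coset_assoc)
  then show ?thesis
    using C rcos_const[OF is_group assms(2)] by simp
qed

text \<open>Since \<open>C #> a = C\<close>, the same representative occurs at both ends. It stands
  uninverted on the left, so in the convention of \<open>conjugate\<close> the conjugating element
  is its inverse.\<close>

lemma factor_eq_conjugate:
  assumes "C \<in> rcosets A" "a \<in> A"
  shows "factor a C = conjugate G a (inv rep C)"
  using assms by (simp add: factor_def conjugate_def rcoset_mult_normal)

lemma finprod_in_conjugate_products:
  assumes "finite I" "g \<in> carrier G"
    and "\<And>i. i \<in> I \<Longrightarrow> f i \<in> A" "\<And>i. i \<in> I \<Longrightarrow> f i \<in> conjugate_products G g n"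
  shows "finprod H f I \<in> conjugate_products G g (n * card I)"
  using assms
proof (induction rule: finite_induct)
  case empty
  then show ?case using conjugate_products_one by simp
next
  case (insert i I)
  have "finprod H f (insert i I) = f i \<otimes>\<^bsub>H\<^esub> finprod H f I"
    by (rule H.finprod_insert) (use insert in auto)
  then show ?case
    using insert conjugate_products_mult[of g "f i" n "finprod H f I" "n * card I"] by simp
qed

lemma generalized_torsion_if_transfer_eq_one:
  assumes g: "g \<in> carrier G" and n: "(n::nat) \<ge> 1" "g [^] n \<in> A" "transfer (g [^] n) = \<one>"
  shows "generalized_torsion G g"
proof -
  have "finprod H (factor (g [^] n)) (rcosets A) \<in> conjugate_products G g (n * card (rcosets A))"
  proof (rule finprod_in_conjugate_products[OF finite_rcosets g])
    fix C assume C: "C \<in> rcosets A"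
    show "factor (g [^] n) C \<in> A"
      using C g by (simp add: factor_closed)
    show "factor (g [^] n) C \<in> conjugate_products G g n"
      unfolding factor_eq_conjugate[OF C n(2)]
      by (rule conjugate_pow_in_conjugate_products) (use C g in auto)
  qed
  \<comment> \<open>\<open>A\<close> is itself a coset, so the number of conjugates collected is
    positive, as generalized torsion demands.\<close>
  moreover have "card (rcosets A) \<noteq> 0"
    using finite_rcosets subgroup_in_rcosets[OF is_group] by auto
  ultimately show ?thesis
    unfolding generalized_torsion_iff using g n(1,3) unfolding transfer_def
    by (intro conjI exI[of _ "n * card (rcosets A)"]) auto
qed

text \<open>The order of the finite quotient by \<open>A\<close> serves as exponent.\<close>

lemma ex_pow_in_A:
  assumes "g \<in> carrier G"
  shows "\<exists>n::nat. n \<ge> 1 \<and> g [^] n \<in> A"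
proof -
  interpret Q: group "G Mod A" by (rule factorgroup_is_group)
  have fin: "finite (carrier (G Mod A))"
    using finite_rcosets by (simp add: FactGroup_def)
  have "A #> g \<in> carrier (G Mod A)"
    using assms by (simp add: carrier_FactGroup)
  then have "(A #> g) [^]\<^bsub>G Mod A\<^esub> order (G Mod A) = \<one>\<^bsub>G Mod A\<^esub>"
    by (rule Q.pow_order_eq_1)
  moreover have "order (G Mod A) \<ge> 1"
    using fin by (simp add: Q.order_gt_0_iff_finite Suc_leI)
  ultimately show ?thesis
    using FactGroup_pow_coset assms by blast
qed

text \<open>One exponent must do two jobs. If \<open>g [^] m\<close> lies in \<open>A\<close>, then
  \<open>n * m\<close> works: the transfer is trivial on \<open>g [^] n\<close> and so on its
  \<open>m\<close>-th power, while the \<open>n\<close>-th power of \<open>g [^] m\<close> stays in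
  \<open>A\<close>.\<close>

lemma generalized_torsion_if_pow_in_derived:
  assumes g: "g \<in> carrier G" and n: "(n::nat) \<ge> 1" "g [^] n \<in> derived G (carrier G)"
  shows "generalized_torsion G g"
proof -
  interpret T: group_hom G H transfer by (rule group_hom_transfer)
  obtain m :: nat where m: "m \<ge> 1" "g [^] m \<in> A"
    using ex_pow_in_A[OF g] by blast
  have "transfer (g [^] n) = \<one>"
    using T.hom_derived_eq_one[OF comm_group_A n(2)] by simp
  then have "transfer ((g [^] n) [^] m) = \<one>"
    using T.hom_nat_pow[of "g [^] n" m] g H.nat_pow_one[of m] by simp
  then have "transfer (g [^] (n * m)) = \<one>"
    using g by (simp add: nat_pow_pow)
  moreover have "g [^] (n * m) = (g [^] m) [^] n"
    using g by (simp add: nat_pow_pow mult.commute)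
  then have "g [^] (n * m) \<in> A"
    using H.nat_pow_closed[of "g [^] m" n] m(2) by (simp flip: nat_pow_consistent)
  moreover have "n * m \<ge> 1" using n m by simp
  ultimately show ?thesis
    using generalized_torsion_if_transfer_eq_one g by blast
qed

section \<open>Centrality of the transfer of elements of \<open>A\<close>\<close>

lemma bij_betw_rcoset_left_mult:
  assumes g: "g \<in> carrier G"
  shows "bij_betw (\<lambda>C. A #> (g \<otimes> rep C)) (rcosets A) (rcosets A)"
proof -
  have "inj_on (\<lambda>C. A #> (g \<otimes> rep C)) (rcosets A)"
  proof (rule inj_onI)
    fix C D assume C: "C \<in> rcosets A" and D: "D \<in> rcosets A"
      and eq: "A #> (g \<otimes> rep C) = A #> (g \<otimes> rep D)"
    have "g \<otimes> rep C \<in> A #> (g \<otimes> rep D)"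
      using eq C g by (intro repr_independenceD subgroup_axioms) auto
    then have "(g \<otimes> rep C) \<otimes> inv (g \<otimes> rep D) \<in> A"
      using D g by (intro rcos_module_imp is_group) auto
    \<comment> \<open>Normality allows \<open>g\<close> to be stripped off by conjugation, leaving
      the quotient of the two representatives in \<open>A\<close>.\<close>
    then have "inv g \<otimes> ((g \<otimes> rep C) \<otimes> inv (g \<otimes> rep D)) \<otimes> g \<in> A"
      using g by (rule inv_op_closed1[rotated])
    also have "inv g \<otimes> ((g \<otimes> rep C) \<otimes> inv (g \<otimes> rep D)) \<otimes> g = rep C \<otimes> inv (rep D)"
      using g C D by (simp add: inv_mult_group m_assoc mult_inv_cancel_left)
    finally have "rep C \<in> A #> rep D"
      using C D by (intro rcos_module_rev is_group) auto
    then show "C = D"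
      using repr_independence[OF _ rep_closed[OF D] subgroup_axioms, of "rep C"] C D
      by (simp add: rcoset_rep)
  qed
  moreover have "(\<lambda>C. A #> (g \<otimes> rep C)) ` (rcosets A) \<subseteq> rcosets A"
    using g subset by (auto intro!: rcosetsI)
  ultimately show ?thesis
    using endo_inj_surj[OF finite_rcosets] by (simp add: bij_betw_def)
qed

text \<open>The chosen representative of the new coset may differ from
  \<open>g \<otimes> rep C\<close> by some \<open>b\<close> in \<open>A\<close>. Conjugation by
  \<open>b\<close> is trivial on the abelian group \<open>A\<close>, so the factor depends on the
  coset alone.\<close>

lemma factor_left_mult:
  assumes g: "g \<in> carrier G" and C: "C \<in> rcosets A" and a: "a \<in> A"
  shows "factor a (A #> (g \<otimes> rep C)) = g \<otimes> factor a C \<otimes> inv g"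
proof -
  define D where "D = A #> (g \<otimes> rep C)"
  have D: "D \<in> rcosets A"
    unfolding D_def using g C subset by (auto intro!: rcosetsI)
  have "rep D \<in> A #> (g \<otimes> rep C)"
    using rep_mem[OF D] by (simp add: D_def)
  then obtain b where b: "b \<in> A" "rep D = b \<otimes> (g \<otimes> rep C)"
    unfolding r_coset_def by blast
  have car: "b \<in> carrier G" "a \<in> carrier G" "rep C \<in> carrier G"
    using a b C subset by auto
  define c where "c = g \<otimes> factor a C \<otimes> inv g"
  have c: "c \<in> A"
    unfolding c_def using g factor_closed[OF C] car(2) by (intro inv_op_closed2)
  have "factor a D = b \<otimes> c \<otimes> inv b"
    using g car C D a unfolding c_def factor_def
    by (simp add: rcoset_mult_normal b(2) inv_mult_group m_assoc)
  also have "\<dots> = c"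
    using A_comm[OF b(1) c] car c by (simp add: m_assoc)
  finally show ?thesis
    unfolding D_def c_def .
qed

lemma transfer_central:
  assumes a: "a \<in> A"
  shows "transfer a \<in> center G"
proof -
  have car: "a \<in> carrier G" using a by simp
  have fac: "factor a \<in> rcosets A \<rightarrow> A"
    using car by (auto simp: factor_closed)
  have T: "transfer a \<in> A"
    unfolding transfer_def using H.finprod_closed[of "factor a" "rcosets A"] fac by simp
  have "transfer a \<otimes> g = g \<otimes> transfer a" if g: "g \<in> carrier G" for g
  proof -
    \<comment> \<open>Conjugation by \<open>g\<close> restricts to an endomorphism of
      \<open>A\<close>, so it can be applied factor by factor; left multiplication by
      \<open>g\<close> on cosets then merely permutes the factors.\<close>
    have "(\<lambda>x. g \<otimes> x \<otimes> inv g) \<in> hom H H"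
      using g inv_op_closed2[OF g] by (intro homI) (simp_all add: m_assoc mult_inv_cancel_left)
    then interpret conj: group_hom H H "\<lambda>x. g \<otimes> x \<otimes> inv g"
      by (intro group_hom.intro group_hom_axioms.intro H.is_group)
    let ?s = "\<lambda>C. A #> (g \<otimes> rep C)"
    have "g \<otimes> transfer a \<otimes> inv g = finprod H (\<lambda>C. g \<otimes> factor a C \<otimes> inv g) (rcosets A)"
      unfolding transfer_def
      by (rule conj.hom_finprod[OF comm_group_A comm_group_A]) (use fac in simp)
    also have "\<dots> = finprod H (\<lambda>C. factor a (?s C)) (rcosets A)"
      by (rule H.finprod_cong')
        (use g a fac in \<open>auto simp: factor_left_mult Pi_iff inv_op_closed2\<close>)
    also have "\<dots> = finprod H (factor a) (?s ` (rcosets A))"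
      by (rule H.finprod_reindex[symmetric])
        (use bij_betw_rcoset_left_mult[OF g] fac in \<open>auto simp: bij_betw_def\<close>)
    also have "\<dots> = transfer a"
      using bij_betw_rcoset_left_mult[OF g] unfolding transfer_def by (simp add: bij_betw_def)
    finally show ?thesis
      using g T by (metis inv_solve_right' m_closed mem_carrier)
  qed
  then show ?thesis
    unfolding center_def using T by simp
qed

text \<open>Some positive power of \<open>g\<close> lies in \<open>A\<close>; its transfer is
  central and therefore trivial.\<close>

lemma generalized_torsion_if_center_trivial:
  assumes "center G = {\<one>}" "g \<in> carrier G"
  shows "generalized_torsion G g"
  using ex_pow_in_A[OF assms(2)] transfer_central assms generalized_torsion_if_transfer_eq_one
  by blast

end

section \<open>Central elements of torsion-free groups, and the combination of all claims\<close>

lemma (in group) center_trivial_if_all_generalized_torsion: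
  assumes "torsion_free G" "generalized_torsion_set G = carrier G"
  shows "center G = {\<one>}"
proof -
  have "z = \<one>" if z: "z \<in> center G" for z
  proof -
    have zc: "z \<in> carrier G" using z unfolding center_def by blast
    \<comment> \<open>A central element equals all its conjugates, so a product of \<open>k\<close>
      of them is its \<open>k\<close>-th power: generalized torsion is then ordinary
      torsion.\<close>
    have conj: "conjugate G z x = z" if "x \<in> carrier G" for x
      using that z zc unfolding center_def conjugate_def by (simp add: m_assoc mult_inv_cancel_left)
    have pow: "foldr (\<otimes>) (map (conjugate G z) xs) \<one> = z [^] length xs"
      if "set xs \<subseteq> carrier G" for xs
      using that by (induction xs) (auto simp: conj simp flip: nat_pow_Suc2[OF zc])
    have "generalized_torsion G z"
      using assms(2) zc unfolding generalized_torsion_set_def by blast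
    then obtain xs where "length xs \<ge> 1" "set xs \<subseteq> carrier G"
        "foldr (\<otimes>) (map (conjugate G z) xs) \<one> = \<one>"
      unfolding generalized_torsion_def by blast
    then have "z \<in> torsion_set G"
      unfolding torsion_set_def using pow zc by auto
    then show ?thesis
      using assms(1) unfolding torsion_free_def by blast
  qed
  moreover have "\<one> \<in> center G" unfolding center_def by simp
  ultimately show ?thesis by blast
qed

theorem theorem1p1:
  fixes G :: "('a, 'b) monoid_scheme"
  assumes "group G" and "finitely_generated G" and "abelian_by_finite G"
  shows "generalized_torsion_set G =
           {g \<in> carrier G. abelianization_map G g \<in> torsion_set (abelianization G)} \<and>
         generalized_torsion_set G \<lhd> G \<and>
         (generalized_torsion_set G = carrier G \<longleftrightarrow> finite (carrier (abelianization G))) \<and>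
         (torsion_free G \<longrightarrow>
           (generalized_torsion_set G = carrier G \<longleftrightarrow> center G = {\<one>\<^bsub>G\<^esub>}))"
proof -
  interpret G: group G by fact
  obtain A where "A \<lhd> G" "comm_group (G\<lparr>carrier := A\<rparr>)" "finite (rcosets\<^bsub>G\<^esub> A)"
    using assms(3) unfolding abelian_by_finite_def by blast
  then interpret A: abelian_normal_finite_index A G
    by (simp add: abelian_normal_finite_index_def abelian_normal_finite_index_axioms_def)
  interpret D: normal "derived G (carrier G)" G
    by (rule G.derived_self_is_normal)
  let ?Q = "abelianization G" and ?p = "abelianization_map G"
  interpret Q: comm_group ?Q
    unfolding abelianization_def by (rule G.derived_quot_is_comm_group)
  interpret p: group_hom G ?Q ?p
    using D.r_coset_hom_Mod
    by (intro group_hom.intro group_hom_axioms.intro assms(1) Q.is_group)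
      (simp add: abelianization_def abelianization_map_def[abs_def])
  have surj: "?p ` carrier G = carrier ?Q"
    by (simp add: abelianization_def abelianization_map_def[abs_def] carrier_FactGroup)
  have pow: "?p g [^]\<^bsub>?Q\<^esub> n = \<one>\<^bsub>?Q\<^esub> \<longleftrightarrow> g [^]\<^bsub>G\<^esub> n \<in> derived G (carrier G)"
    if "g \<in> carrier G" for g and n :: nat
    using D.FactGroup_pow_coset[OF that, of n] by (simp add: abelianization_def abelianization_map_def)
  have torsion: "generalized_torsion G g \<longleftrightarrow> ?p g \<in> torsion_set ?Q" if g: "g \<in> carrier G" for g
  proof
    assume "generalized_torsion G g"
    then obtain n where "n \<ge> 1" "\<one>\<^bsub>G\<^esub> \<in> conjugate_products G g n"
      unfolding generalized_torsion_iff by blast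
    moreover from this(2) have "?p g [^]\<^bsub>?Q\<^esub> n = \<one>\<^bsub>?Q\<^esub>"
      using p.hom_conjugate_products[OF Q.comm_group_axioms g] p.hom_one by metis
    ultimately show "?p g \<in> torsion_set ?Q"
      unfolding torsion_set_def using p.hom_closed[OF g] by blast
  next
    assume "?p g \<in> torsion_set ?Q"
    then show "generalized_torsion G g"
      unfolding torsion_set_def using pow[OF g] A.generalized_torsion_if_pow_in_derived[OF g] by auto
  qed
  then have eq: "generalized_torsion_set G = {g \<in> carrier G. ?p g \<in> torsion_set ?Q}"
    unfolding generalized_torsion_set_def generalized_torsion_def by blast
  moreover have "generalized_torsion_set G \<lhd> G"
    unfolding eq by (rule p.normal_vimage_comm_group[OF Q.comm_group_axioms Q.subgroup_torsion_set])
  moreover have "generalized_torsion_set G = carrier G \<longleftrightarrow> finite (carrier ?Q)"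
  proof -
    \<comment> \<open>Surjectivity of the abelianization map turns a condition on all elements of
      \<open>G\<close> into one on all elements of the abelianization.\<close>
    have "generalized_torsion_set G = carrier G \<longleftrightarrow> carrier ?Q \<subseteq> torsion_set ?Q"
      unfolding eq surj[symmetric] by blast
    also have "\<dots> \<longleftrightarrow> torsion_set ?Q = carrier ?Q"
      unfolding torsion_set_def by blast
    finally show ?thesis
      using Q.finite_iff_torsion p.finitely_generated_image[OF assms(2) surj] by simp
  qed
  moreover have "generalized_torsion_set G = carrier G \<longleftrightarrow> center G = {\<one>\<^bsub>G\<^esub>}" if "torsion_free G"
  proof
    show "generalized_torsion_set G = carrier G" if "center G = {\<one>\<^bsub>G\<^esub>}"
      using A.generalized_torsion_if_center_trivial[OF that]
      unfolding generalized_torsion_set_def generalized_torsion_def by blast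
  qed (rule G.center_trivial_if_all_generalized_torsion[OF that])
  ultimately show ?thesis by blast
qed

end
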